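(* Let $r\ge2$ and let $\mathcal{U}=\{C_1,\ldots,C_s\}$ be a finite collection of $r$-uniform hypergraphs with hypergraph profile $\mathcal{G}_\mathcal{U}$. Then $$\operatorname{trop}(\mathcal{G}_\mathcal{U})=\operatorname{cl}(\operatorname{cone}(\log(\mathcal{G}_\mathcal{U})))=\operatorname{cl}(\operatorname{conv}(\log(\mathcal{G}_\mathcal{U})))\subseteq\mathbb{R}^s_{\le 0}.$$ Further, for any $\epsilon>0$, $\operatorname{trop}(\mathcal{G}_\mathcal{U})$ is determined by the nonempty neighborhood $\mathcal{G}_\mathcal{U}\cap B(\mathbf 0,\epsilon)$, where $B(\mathbf 0,\epsilon)$ is the ball with center $\mathbf 0$ and radius $\epsilon$ (i.e., for $\mathbf a,\mathbf b\in\mathbb{R}^s$, the inequality $\mathbf a^\top\mathbf y\ge\mathbf b^\top\mathbf y$ holds for all $\mathbf y\in\operatorname{trop}(\mathcal{G}_\mathcal{U})$ iff it holds for all $\mathbf y\in\log(\mathcal{G}_\mathcal{U}\cap B(\mathbf 0,\epsilon))$).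
   Context: An $r$-uniform hypergraph has edges that are $r$-element subsets of its finite vertex set. A homomorphism $H\to G$ of $r$-uniform hypergraphs is a map $\varphi:V(H)\to V(G)$ such that $\{\varphi(u_1),\ldots,\varphi(u_r)\}\in E(G)$ for every $\{u_1,\ldots,u_r\}\in E(H)$; the homomorphism density $t(H;G)$ is the number of homomorphisms divided by $|V(G)|^{|V(H)|}$. The profile $\mathcal{G}_\mathcal{U}$ is the closure of $\{(t(C_1;G),\ldots,t(C_s;G))\}$ over all $r$-uniform hypergraphs $G$. For $\mathcal S\subseteq\mathbb{R}^s_{\ge0}$, $\log(\mathcal S)$ is the image of $\mathcal S\cap\mathbb{R}^s_{>0}$ under coordinatewise natural log. $\operatorname{trop}(\mathcal S)$ is the set of $\mathbf y$ for which there exist $\tau_k\in(0,1)$, $\tau_k\to0$, and $\mathbf y(k)\in\mathcal S\cap\mathbb{R}^s_{>0}$ with $\frac{-1}{\log_e\tau_k}\log(\mathbf y(k))\to\mathbf y$. $\operatorname{cone},\operatorname{conv},\operatorname{cl}$ denote conical hull, convex hull, closure.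
   Formalization: If some C_i has no edges, its density is always 1 and the profile misses small balls around 0, so the "Further" claim fails; here nonemptiness is claimed when every C_i has an edge, and the equivalence for every ε for which the neighborhood is nonempty. *)

theory Defs
  imports "HOL-Analysis.Analysis"
begin

datatype 'v hypergraph = Hypergraph (verts: "'v set") (edges: "'v set set")

definition uniform_hypergraph :: "nat \<Rightarrow> 'v hypergraph \<Rightarrow> bool" where
  "uniform_hypergraph r H \<longleftrightarrow>
     finite (verts H) \<and> (\<forall>e\<in>edges H. e \<subseteq> verts H \<and> card e = r)"

text \<open>Homomorphisms are extensional functions, so that maps agreeing on
  the vertex set of \<open>H\<close> are counted once.\<close>

definition hypergraph_homs :: "'v hypergraph \<Rightarrow> 'w hypergraph \<Rightarrow> ('v \<Rightarrow> 'w) set" where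
  "hypergraph_homs H G =
     {\<phi> \<in> verts H \<rightarrow>\<^sub>E verts G. \<forall>e\<in>edges H. \<phi> ` e \<in> edges G}"

definition hom_density :: "'v hypergraph \<Rightarrow> 'w hypergraph \<Rightarrow> real" where
  "hom_density H G =
     real (card (hypergraph_homs H G)) / real (card (verts G) ^ card (verts H))"

text \<open>Densities are invariant under isomorphism of the target, so letting
  \<open>G\<close> range over the hypergraphs with vertices in \<open>nat\<close> covers all finite ones.
  The target must have a vertex for the density to make sense.\<close>

definition hypergraph_profile :: "nat \<Rightarrow> ('n::finite \<Rightarrow> 'v hypergraph) \<Rightarrow> (real ^ 'n) set" where
  "hypergraph_profile r C =
     closure {(\<chi> i. hom_density (C i) G) | G :: nat hypergraph.
                uniform_hypergraph r G \<and> verts G \<noteq> {}}"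

definition pos_orthant :: "(real ^ 'n::finite) set" where
  "pos_orthant = {y. \<forall>i. 0 < y $ i}"

definition ln_vec :: "real ^ 'n::finite \<Rightarrow> real ^ 'n" where
  "ln_vec y = (\<chi> i. ln (y $ i))"

definition log_set :: "(real ^ 'n::finite) set \<Rightarrow> (real ^ 'n) set" where
  "log_set S = ln_vec ` (S \<inter> pos_orthant)"

definition trop :: "(real ^ 'n::finite) set \<Rightarrow> (real ^ 'n) set" where
  "trop S = {y. \<exists>(\<tau> :: nat \<Rightarrow> real) (Y :: nat \<Rightarrow> real ^ 'n).
     (\<forall>k. 0 < \<tau> k \<and> \<tau> k < 1) \<and> \<tau> \<longlonglongrightarrow> 0 \<and>
     (\<forall>k. Y k \<in> S \<inter> pos_orthant) \<and>
     (\<lambda>k. (- 1 / ln (\<tau> k)) *\<^sub>R ln_vec (Y k)) \<longlonglongrightarrow> y}"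

end

theory Submission
  imports Defs "HOL-Real_Asymp.Real_Asymp"
begin

text \<open>Densities are multiplicative under the categorical product of hypergraphs, and those of large
  complete hypergraphs tend to \<open>1\<close>. So the profile is a multiplicative monoid in the unit cube, and
  its logarithm \<open>L\<close> is an additive monoid in the negative orthant. Since \<open>L\<close> contains \<open>0\<close> and is
  stable under natural multiples, its convex hull is already a cone; rounding real coefficients to
  multiples of \<open>1/m\<close> approximates each point of that cone by points of \<open>(1/m) L\<close>, which gives
  tropicalisation. For the localisation at the origin, multiplying the powers of a point \<open>x\<close> of the
  profile by one fixed positive point of the small ball stays inside the ball, and the linear
  inequality at \<open>ln x\<close> is recovered asymptotically.\<close>

section \<open>Multiplicative monoids in the unit cube\<close>

lemma ln_vec_mult:
  assumes "x \<in> pos_orthant" "y \<in> pos_orthant"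
  shows "ln_vec (x * y) = ln_vec x + ln_vec y"
  using assms by (simp add: vec_eq_iff ln_vec_def pos_orthant_def ln_mult less_imp_neq[symmetric])

lemma pos_orthant_mult: "x \<in> pos_orthant \<Longrightarrow> y \<in> pos_orthant \<Longrightarrow> x * y \<in> pos_orthant"
  by (simp add: pos_orthant_def)

lemma log_set_add:
  assumes "\<And>x y. x \<in> M \<Longrightarrow> y \<in> M \<Longrightarrow> x * y \<in> M" and "u \<in> log_set M" "v \<in> log_set M"
  shows "u + v \<in> log_set M"
proof -
  obtain x y where "x \<in> M" "x \<in> pos_orthant" "u = ln_vec x"
    "y \<in> M" "y \<in> pos_orthant" "v = ln_vec y"
    using assms(2,3) by (auto simp: log_set_def)
  then show ?thesis
    using assms(1) by (auto simp: log_set_def ln_vec_mult pos_orthant_mult intro!: image_eqI[of _ _ "x * y"])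
qed

lemma zero_in_log_set: "1 \<in> M \<Longrightarrow> 0 \<in> log_set M"
  by (auto simp: log_set_def pos_orthant_def ln_vec_def vec_eq_iff intro!: image_eqI[of _ _ 1])

section \<open>Convex hulls and convex cones of additive monoids\<close>

lemma additive_monoid_of_nat_scaleR:
  fixes L :: "'a::real_vector set"
  assumes "0 \<in> L" and "\<And>u v. u \<in> L \<Longrightarrow> v \<in> L \<Longrightarrow> u + v \<in> L" and "u \<in> L"
  shows "real m *\<^sub>R u \<in> L"
  by (induction m) (use assms in \<open>auto simp: algebra_simps\<close>)

text \<open>Only stability of the convex hull under scaling by \<open>c \<ge> 0\<close> needs an
  argument: natural multiples stay in the hull because \<open>L\<close> is a monoid, and every other
  multiple lies on a segment from \<open>0\<close> to a natural one.\<close>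

lemma convex_cone_hull_eq_convex_hull:
  fixes L :: "'a::real_vector set"
  assumes zero: "0 \<in> L" and add: "\<And>u v. u \<in> L \<Longrightarrow> v \<in> L \<Longrightarrow> u + v \<in> L"
  shows "convex_cone hull L = convex hull L"
proof (rule antisym)
  have cv: "convex (convex hull L)" by (rule convex_convex_hull)
  have z: "0 \<in> convex hull L" using zero by (rule hull_inc)
  have scale: "c *\<^sub>R x \<in> convex hull L" if x: "x \<in> convex hull L" and c: "c \<ge> 0" for c x
  proof -
    \<comment> \<open>Any natural number above \<open>c\<close> makes \<open>c / real m\<close> a
      legitimate convex weight.\<close>
    obtain m :: nat where m: "c < real m" using reals_Archimedean2 by blast
    have "(\<lambda>u. real m *\<^sub>R u) ` L \<subseteq> L"
      using additive_monoid_of_nat_scaleR[OF assms] by auto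
    then have "real m *\<^sub>R x \<in> convex hull L"
      using hull_mono[of "(\<lambda>u. real m *\<^sub>R u) ` L" L convex] x unfolding convex_hull_scaling by blast
    then have "(1 - c / real m) *\<^sub>R 0 + (c / real m) *\<^sub>R (real m *\<^sub>R x) \<in> convex hull L"
      by (intro convexD[OF cv z]) (use c m in auto)
    then show ?thesis using m c by auto
  qed
  have "convex_cone (convex hull L)"
    using z cv scale by (auto simp: convex_cone_def conic_def)
  then show "convex_cone hull L \<subseteq> convex hull L"
    by (intro hull_minimal hull_subset)
  show "convex hull L \<subseteq> convex_cone hull L"
    by (intro hull_minimal hull_subset convex_convex_cone_hull)
qed

text \<open>The set \<open>T\<close> of all such limits contains \<open>L\<close> and is itself a
  convex cone, so it contains the hull. The scales \<open>1 / real m\<close> are what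
  \<open>trop\<close> later realises as \<open>- 1 / ln (\<tau> k)\<close>.\<close>

lemma convex_cone_hull_limit_of_monoid:
  fixes L :: "'a::real_normed_vector set"
  assumes zero: "0 \<in> L" and add: "\<And>u v. u \<in> L \<Longrightarrow> v \<in> L \<Longrightarrow> u + v \<in> L"
    and x: "x \<in> convex_cone hull L"
  shows "\<exists>l. (\<forall>m. l m \<in> L) \<and> (\<lambda>m. (1 / real m) *\<^sub>R l m) \<longlonglongrightarrow> x"
proof -
  define T where "T = {x. \<exists>l. (\<forall>m. l m \<in> L) \<and> (\<lambda>m. (1 / real m) *\<^sub>R l m) \<longlonglongrightarrow> x}"
  have TI: "x \<in> T" if "\<And>m. l m \<in> L" "(\<lambda>m. (1 / real m) *\<^sub>R l m) \<longlonglongrightarrow> x" for l x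
    using that by (auto simp: T_def)
  have "L \<subseteq> T"
  proof
    fix u assume u: "u \<in> L"
    show "u \<in> T"
    proof (rule TI)
      show "real m *\<^sub>R u \<in> L" for m
        by (rule additive_monoid_of_nat_scaleR[OF assms(1,2) u])
      \<comment> \<open>At \<open>m = 0\<close> the factor \<open>1 / real m\<close> is
        \<open>0\<close>, so the identity holds only eventually.\<close>
      have "eventually (\<lambda>m. u = (1 / real m) *\<^sub>R (real m *\<^sub>R u)) sequentially"
        using eventually_gt_at_top[of 0] by eventually_elim simp
      then show "(\<lambda>m. (1 / real m) *\<^sub>R (real m *\<^sub>R u)) \<longlonglongrightarrow> u"
        by (rule Lim_transform_eventually[OF tendsto_const])
    qed
  qed
  moreover have "convex_cone T"
    unfolding convex_cone_iff
  proof (intro conjI ballI allI impI)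
    show T0: "0 \<in> T" by (rule TI[where l = "\<lambda>_. 0"]) (use zero in auto)
    fix x assume "x \<in> T"
    then obtain l where l: "\<And>m. l m \<in> L" and lx: "(\<lambda>m. (1 / real m) *\<^sub>R l m) \<longlonglongrightarrow> x"
      by (auto simp: T_def)
    {
      fix y assume "y \<in> T"
      then obtain k where k: "\<And>m. k m \<in> L" and ky: "(\<lambda>m. (1 / real m) *\<^sub>R k m) \<longlonglongrightarrow> y"
        by (auto simp: T_def)
      show "x + y \<in> T"
        by (rule TI[where l = "\<lambda>m. l m + k m"])
          (use l k add tendsto_add[OF lx ky] in \<open>auto simp: scaleR_add_right\<close>)
    next
      fix c :: real assume "0 \<le> c"
      show "c *\<^sub>R x \<in> T"
      proof (cases "c = 0")
        case False
        with \<open>0 \<le> c\<close> have c: "c > 0" by simp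
        \<comment> \<open>Reindexing along the integer part of \<open>c * real m\<close> scales the
          limit by \<open>c\<close>: \<open>l (?n m) / m\<close> is the product of
          \<open>?n m / m\<close>, which tends to \<open>c\<close>, and
          \<open>l (?n m) / ?n m\<close>, which tends to \<open>x\<close>.\<close>
        let ?n = "\<lambda>m::nat. nat \<lfloor>c * real m\<rfloor>"
        have n: "filterlim ?n at_top sequentially" using c by real_asymp
        have nm: "(\<lambda>m. real (?n m) / real m) \<longlonglongrightarrow> c" using c by real_asymp
        have lim: "(\<lambda>m. (real (?n m) / real m) *\<^sub>R ((1 / real (?n m)) *\<^sub>R l (?n m))) \<longlonglongrightarrow> c *\<^sub>R x"
          by (intro tendsto_scaleR nm filterlim_compose[OF lx n])
        have "eventually (\<lambda>m. ?n m > 0) sequentially"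
          using n eventually_gt_at_top by (rule eventually_compose_filterlim[rotated])
        then have "eventually (\<lambda>m. (real (?n m) / real m) *\<^sub>R ((1 / real (?n m)) *\<^sub>R l (?n m))
            = (1 / real m) *\<^sub>R l (?n m)) sequentially"
          by (rule eventually_mono) (simp del: zero_less_nat_eq of_nat_nat nat_0_iff)
        then have "(\<lambda>m. (1 / real m) *\<^sub>R l (?n m)) \<longlonglongrightarrow> c *\<^sub>R x"
          by (rule Lim_transform_eventually[OF lim])
        then show ?thesis using l by (intro TI[where l = "\<lambda>m. l (?n m)"])
      qed (use T0 in simp)
    }
  qed
  ultimately have "convex_cone hull L \<subseteq> T" by (rule hull_minimal)
  then show ?thesis using x by (auto simp: T_def)
qed

text \<open>Terms of a tropical sequence are nonnegative multiples of points of
  \<open>log_set M\<close>, which gives one inclusion. Conversely, a point of the closure is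
  approximated first by points of the cone, then by \<open>1 / real m\<close> times a point of
  \<open>log_set M\<close>; a diagonal choice of \<open>m\<close> yields the required
  sequence.\<close>

lemma trop_eq_closure_convex_cone_hull:
  assumes one: "1 \<in> M" and mult: "\<And>x y. x \<in> M \<Longrightarrow> y \<in> M \<Longrightarrow> x * y \<in> M"
  shows "trop M = closure (convex_cone hull (log_set M))"
proof (rule antisym)
  show "trop M \<subseteq> closure (convex_cone hull (log_set M))"
  proof
    fix y assume "y \<in> trop M"
    then obtain \<tau> Y where \<tau>: "\<And>k. 0 < \<tau> k" "\<And>k. \<tau> k < 1" and Y: "\<And>k. Y k \<in> M \<inter> pos_orthant"
      and lim: "(\<lambda>k. (- 1 / ln (\<tau> k)) *\<^sub>R ln_vec (Y k)) \<longlonglongrightarrow> y"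
      unfolding trop_def by blast
    have "(- 1 / ln (\<tau> k)) *\<^sub>R ln_vec (Y k) \<in> convex_cone hull (log_set M)" for k
    proof (rule convex_cone_scaleR[OF convex_cone_convex_cone_hull])
      show "0 \<le> - 1 / ln (\<tau> k)"
        using ln_less_zero[OF \<tau>(1)[of k] \<tau>(2)[of k]] by (simp add: divide_nonneg_neg)
      show "ln_vec (Y k) \<in> convex_cone hull (log_set M)"
        using Y[of k] by (auto simp: log_set_def intro!: hull_inc)
    qed
    then show "y \<in> closure (convex_cone hull (log_set M))"
      using lim by (auto simp: closure_sequential intro!: exI)
  qed
next
  have L0: "0 \<in> log_set M" using one by (rule zero_in_log_set)
  have Ladd: "u + v \<in> log_set M" if "u \<in> log_set M" "v \<in> log_set M" for u v
    using mult that by (rule log_set_add)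
  show "closure (convex_cone hull (log_set M)) \<subseteq> trop M"
  proof
    fix y assume y: "y \<in> closure (convex_cone hull (log_set M))"
    \<comment> \<open>The error bound adds two errors of \<open>1 / real (Suc k)\<close>, one for
      each approximation; \<open>m > k\<close> will force the scales to tend to zero.\<close>
    have "\<exists>m x. m > k \<and> x \<in> M \<inter> pos_orthant \<and>
        dist ((1 / real m) *\<^sub>R ln_vec x) y < 2 / real (Suc k)" for k
    proof -
      obtain z where z: "z \<in> convex_cone hull (log_set M)" "dist z y < 1 / real (Suc k)"
        using y unfolding closure_approachable by (metis of_nat_0_less_iff zero_less_Suc zero_less_divide_1_iff)
      obtain l where l: "\<And>m. l m \<in> log_set M" and lim: "(\<lambda>m. (1 / real m) *\<^sub>R l m) \<longlonglongrightarrow> z"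
        using convex_cone_hull_limit_of_monoid[OF L0 Ladd z(1)] by blast
      have "eventually (\<lambda>m. dist ((1 / real m) *\<^sub>R l m) z < 1 / real (Suc k)) sequentially"
        using tendstoD[OF lim] by simp
      then have "eventually (\<lambda>m. m > k \<and> dist ((1 / real m) *\<^sub>R l m) z < 1 / real (Suc k)) sequentially"
        using eventually_gt_at_top[of k] by eventually_elim simp
      then obtain m where m: "m > k" "dist ((1 / real m) *\<^sub>R l m) z < 1 / real (Suc k)"
        by (auto simp: eventually_sequentially)
      have "dist ((1 / real m) *\<^sub>R l m) y \<le> dist ((1 / real m) *\<^sub>R l m) z + dist z y"
        by (rule dist_triangle)
      also have "\<dots> < 2 / real (Suc k)" using m(2) z(2) by simp
      finally have "dist ((1 / real m) *\<^sub>R l m) y < 2 / real (Suc k)" .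
      moreover obtain x where "x \<in> M \<inter> pos_orthant" "l m = ln_vec x"
        using l[of m] unfolding log_set_def by (rule imageE)
      ultimately show ?thesis using m(1) by (intro exI[of _ m] exI[of _ x]) simp
    qed
    then obtain m x where m: "\<And>k. m k > k" and x: "\<And>k. x k \<in> M \<inter> pos_orthant"
      and d: "\<And>k. dist ((1 / real (m k)) *\<^sub>R ln_vec (x k)) y < 2 / real (Suc k)"
      by metis
    have "(\<lambda>k. (1 / real (m k)) *\<^sub>R ln_vec (x k)) \<longlonglongrightarrow> y"
    proof (rule metric_tendsto_imp_tendsto[where f = "\<lambda>k. 2 / real (Suc k)" and a = 0])
      show "(\<lambda>k. 2 / real (Suc k)) \<longlonglongrightarrow> 0" by real_asymp
    qed (use d in \<open>auto intro!: always_eventually less_imp_le\<close>)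
    \<comment> \<open>With \<open>\<tau> k = exp (- real (m k))\<close> the factor
      \<open>- 1 / ln (\<tau> k)\<close> is exactly \<open>1 / real (m k)\<close>.\<close>
    moreover have "(\<lambda>k. exp (- real (m k))) \<longlonglongrightarrow> 0"
    proof (rule tendsto_sandwich[OF _ _ tendsto_const])
      show "(\<lambda>k. exp (- real k)) \<longlonglongrightarrow> 0" by real_asymp
    qed (use m in \<open>auto intro!: always_eventually less_imp_le\<close>)
    moreover have "0 < m k" for k using m[of k] by simp
    ultimately show "y \<in> trop M"
      unfolding trop_def using x
      by (auto intro!: exI[of _ "\<lambda>k. exp (- real (m k))"] exI[of _ x])
  qed
qed

lemma closure_convex_hull_log_set_nonpos:
  assumes "\<And>x i. x \<in> M \<Longrightarrow> x $ i \<le> 1"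
  shows "closure (convex hull (log_set M)) \<subseteq> {y. \<forall>i. y $ i \<le> 0}"
proof (rule closure_minimal)
  have eq: "{y. \<forall>i. y $ i \<le> 0} = (\<Inter>i. {y :: real ^ 'a. y $ i \<le> 0})" by auto
  have "closed {y :: real ^ 'a. y $ i \<le> 0}" for i
    by (rule closed_halfspace_component_le_cart)
  then show "closed {y :: real ^ 'a. \<forall>i. y $ i \<le> 0}"
    unfolding eq by (intro closed_INT ballI)
  have "convex {y :: real ^ 'a. \<forall>i. y $ i \<le> 0}"
    by (auto simp: convex_def intro!: add_nonpos_nonpos mult_nonneg_nonpos)
  moreover have "log_set M \<subseteq> {y. \<forall>i. y $ i \<le> 0}"
    using assms by (auto simp: log_set_def ln_vec_def pos_orthant_def)
  ultimately show "convex hull (log_set M) \<subseteq> {y. \<forall>i. y $ i \<le> 0}"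
    by (rule hull_minimal[rotated])
qed

text \<open>The points \<open>q * x ^ m\<close> stay in the ball, so
  \<open>c \<bullet> ln_vec q + real m * (c \<bullet> y)\<close> is nonnegative for every
  \<open>m\<close>, which is impossible if \<open>c \<bullet> y\<close> is negative. The vector
  \<open>c\<close> will be the difference \<open>a - b\<close>.\<close>

lemma linear_inequality_on_log_set_if_near_zero:
  fixes M :: "(real ^ 'n::finite) set"
  assumes mult: "\<And>x y. x \<in> M \<Longrightarrow> y \<in> M \<Longrightarrow> x * y \<in> M"
    and le1: "\<And>x i. x \<in> M \<Longrightarrow> x $ i \<le> 1"
    and q: "q \<in> M" "q \<in> pos_orthant" "norm q < \<epsilon>"
    and ineq: "\<And>y. y \<in> log_set (M \<inter> ball 0 \<epsilon>) \<Longrightarrow> 0 \<le> c \<bullet> y"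
    and y: "y \<in> log_set M"
  shows "0 \<le> c \<bullet> y"
proof -
  obtain x where x: "x \<in> M" "x \<in> pos_orthant" "y = ln_vec x"
    using y by (auto simp: log_set_def)
  have *: "q * x ^ m \<in> M \<and> q * x ^ m \<in> pos_orthant \<and> norm (q * x ^ m) < \<epsilon>
      \<and> ln_vec (q * x ^ m) = ln_vec q + real m *\<^sub>R y" for m
  proof (induction m)
    case (Suc m)
    let ?z = "q * x ^ m"
    have eq: "q * x ^ Suc m = ?z * x" by (simp add: mult_ac)
    \<comment> \<open>All coordinates of \<open>x\<close> lie between \<open>0\<close> and
      \<open>1\<close>, so multiplying by \<open>x\<close> shrinks every coordinate.\<close>
    have "norm (?z * x) \<le> norm ?z"
      by (rule norm_le_componentwise_cart)
        (use Suc x le1[OF x(1)] in \<open>auto simp: pos_orthant_def abs_mult less_imp_le intro!: mult_left_le\<close>)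
    then show ?case
      unfolding eq using Suc x mult[of ?z x] ln_vec_mult[of ?z x] pos_orthant_mult[of ?z x]
      by (simp add: scaleR_add_left)
  qed (use q in auto)
  have "0 \<le> c \<bullet> ln_vec q + real m * (c \<bullet> y)" for m
  proof -
    have "ln_vec (q * x ^ m) \<in> log_set (M \<inter> ball 0 \<epsilon>)"
      unfolding log_set_def using *[of m] by (intro imageI) simp
    from ineq[OF this] show ?thesis using *[of m] by (simp add: inner_add_right)
  qed
  note ge = this
  show ?thesis
  proof (rule ccontr)
    assume "\<not> ?thesis"
    then have neg: "0 < - (c \<bullet> y)" by simp
    obtain m where "c \<bullet> ln_vec q < real m * (- (c \<bullet> y))"
      using reals_Archimedean3[OF neg] by blast
    with ge[of m] show False by simp
  qed
qed

section \<open>Homomorphism densities\<close>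

text \<open>The categorical product, encoded on \<open>nat\<close> because the profile ranges over
  hypergraphs with vertices in \<open>nat\<close>. For \<open>r\<close>-uniform factors,
  \<open>card e = r\<close> makes both projections injective on each edge.\<close>

definition hypergraph_product :: "nat \<Rightarrow> nat hypergraph \<Rightarrow> nat hypergraph \<Rightarrow> nat hypergraph" where
  "hypergraph_product r G G' = Hypergraph (prod_encode ` (verts G \<times> verts G'))
     {e. e \<subseteq> prod_encode ` (verts G \<times> verts G') \<and> card e = r \<and>
         (fst \<circ> prod_decode) ` e \<in> edges G \<and> (snd \<circ> prod_decode) ` e \<in> edges G'}"

definition complete_hypergraph :: "nat \<Rightarrow> nat \<Rightarrow> nat hypergraph" where
  "complete_hypergraph r n = Hypergraph {..<n} {e. e \<subseteq> {..<n} \<and> card e = r}"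

section \<open>Elementary bounds on densities\<close>

lemma finite_hypergraph_homs:
  "finite (verts H) \<Longrightarrow> finite (verts G) \<Longrightarrow> finite (hypergraph_homs H G)"
  by (rule finite_subset[of _ "verts H \<rightarrow>\<^sub>E verts G"]) (auto simp: hypergraph_homs_def intro!: finite_PiE)

lemma hom_density_le_1:
  assumes "finite (verts H)" "finite (verts G)"
  shows "hom_density H G \<le> 1"
proof -
  have "card (hypergraph_homs H G) \<le> card (verts H \<rightarrow>\<^sub>E verts G)"
    using assms by (intro card_mono finite_PiE) (auto simp: hypergraph_homs_def)
  then have "real (card (hypergraph_homs H G)) \<le> real (card (verts G) ^ card (verts H))"
    using assms by (simp only: card_funcsetE of_nat_le_iff)
  then show ?thesis unfolding hom_density_def by (intro divide_le_eq_1[THEN iffD2]) auto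
qed

lemma hom_density_edgeless:
  assumes "finite (verts H)" "finite (verts G)" "verts G \<noteq> {}" "edges H = {}"
  shows "hom_density H G = 1"
  using assms by (simp add: hom_density_def hypergraph_homs_def card_funcsetE)

text \<open>A constant map collapses an edge to a singleton, which is not an edge when
  \<open>r \<ge> 2\<close>, so not every map is a homomorphism.\<close>

lemma hom_density_less_1:
  assumes H: "uniform_hypergraph r H" "edges H \<noteq> {}" and G: "uniform_hypergraph r G" "verts G \<noteq> {}"
    and r: "2 \<le> r"
  shows "hom_density H G < 1"
proof -
  obtain v e where v: "v \<in> verts G" and e: "e \<in> edges H" using H G by auto
  have fin: "finite (verts H)" "finite (verts G)" using H G by (auto simp: uniform_hypergraph_def)
  define \<phi> where "\<phi> = (\<lambda>u\<in>verts H. v)"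
  have "e \<subseteq> verts H" "card e = r" using H e by (auto simp: uniform_hypergraph_def)
  moreover from this r have "e \<noteq> {}" by auto
  ultimately have "\<phi> ` e = {v}" by (auto simp: \<phi>_def)
  then have "\<phi> ` e \<notin> edges G" using G r by (auto simp: uniform_hypergraph_def)
  then have "\<phi> \<notin> hypergraph_homs H G" using e by (auto simp: hypergraph_homs_def)
  moreover have "\<phi> \<in> verts H \<rightarrow>\<^sub>E verts G" using v by (auto simp: \<phi>_def)
  ultimately have "hypergraph_homs H G \<subset> verts H \<rightarrow>\<^sub>E verts G" by (auto simp: hypergraph_homs_def)
  then have "card (hypergraph_homs H G) < card (verts H \<rightarrow>\<^sub>E verts G)"
    using fin by (intro psubset_card_mono finite_PiE) auto
  then have "real (card (hypergraph_homs H G)) < real (card (verts G) ^ card (verts H))"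
    using fin by (simp only: card_funcsetE of_nat_less_iff)
  then show ?thesis unfolding hom_density_def by (intro divide_less_eq_1[THEN iffD2]) auto
qed

section \<open>Densities under the categorical product\<close>

lemma uniform_hypergraph_product:
  "uniform_hypergraph r G \<Longrightarrow> uniform_hypergraph r G' \<Longrightarrow> uniform_hypergraph r (hypergraph_product r G G')"
  by (auto simp: uniform_hypergraph_def hypergraph_product_def)

text \<open>This is the universal property of the product: a homomorphism into it is the same as a
  pair of homomorphisms into the factors.\<close>

lemma card_hypergraph_homs_product:
  assumes H: "uniform_hypergraph r H" and G: "uniform_hypergraph r G"
  shows "card (hypergraph_homs H (hypergraph_product r G G'))
    = card (hypergraph_homs H G) * card (hypergraph_homs H G')"
proof -
  define F where "F = (\<lambda>(f, g). \<lambda>u\<in>verts H. prod_encode (f u :: nat, g u :: nat))"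
  define B where "B = (\<lambda>\<phi>. (\<lambda>u\<in>verts H. fst (prod_decode (\<phi> u)), \<lambda>u\<in>verts H. snd (prod_decode (\<phi> u))))"
  have sub: "e \<subseteq> verts H" "card e = r" if "e \<in> edges H" for e
    using H that by (auto simp: uniform_hypergraph_def)
  have "bij_betw F (hypergraph_homs H G \<times> hypergraph_homs H G')
      (hypergraph_homs H (hypergraph_product r G G'))"
  proof (rule bij_betw_byWitness[where f' = B])
    show "\<forall>p\<in>hypergraph_homs H G \<times> hypergraph_homs H G'. B (F p) = p"
      by (auto simp: F_def B_def hypergraph_homs_def PiE_def fun_eq_iff extensional_def)
    show "\<forall>\<phi>\<in>hypergraph_homs H (hypergraph_product r G G'). F (B \<phi>) = \<phi>"
      by (auto simp: F_def B_def hypergraph_homs_def PiE_def fun_eq_iff extensional_def)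
    show "F ` (hypergraph_homs H G \<times> hypergraph_homs H G') \<subseteq> hypergraph_homs H (hypergraph_product r G G')"
    proof clarify
      fix f g assume f: "f \<in> hypergraph_homs H G" and g: "g \<in> hypergraph_homs H G'"
      let ?\<phi> = "F (f, g)"
      have mem: "?\<phi> u \<in> prod_encode ` (verts G \<times> verts G')" if "u \<in> verts H" for u
        using f g that by (auto simp: F_def hypergraph_homs_def)
      have "?\<phi> ` e \<in> edges (hypergraph_product r G G')" if e: "e \<in> edges H" for e
      proof -
        have fe: "(fst \<circ> prod_decode) ` (?\<phi> ` e) = f ` e" and ge: "(snd \<circ> prod_decode) ` (?\<phi> ` e) = g ` e"
          using sub(1)[OF e] by (auto simp: F_def image_image subset_iff intro!: image_cong)
        have edge: "f ` e \<in> edges G" "g ` e \<in> edges G'"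
          using f g e by (auto simp: hypergraph_homs_def)
        have fin: "finite e" using sub(1)[OF e] H by (auto simp: uniform_hypergraph_def intro: finite_subset)
        have "r = card (f ` e)" using edge(1) G by (auto simp: uniform_hypergraph_def)
        also have "\<dots> \<le> card (?\<phi> ` e)" unfolding fe[symmetric] using fin by (intro card_image_le) auto
        finally have "card (?\<phi> ` e) = r"
          using card_image_le[OF fin, of ?\<phi>] sub(2)[OF e] by simp
        then show ?thesis
          using fe ge edge mem sub(1)[OF e] by (auto simp: hypergraph_product_def)
      qed
      moreover have "?\<phi> \<in> extensional (verts H)" by (simp add: F_def)
      ultimately show "?\<phi> \<in> hypergraph_homs H (hypergraph_product r G G')"
        using mem by (auto simp: hypergraph_homs_def PiE_def hypergraph_product_def)
    qed
    show "B ` hypergraph_homs H (hypergraph_product r G G') \<subseteq> hypergraph_homs H G \<times> hypergraph_homs H G'"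
    proof clarify
      fix \<phi> f g
      assume \<phi>: "\<phi> \<in> hypergraph_homs H (hypergraph_product r G G')" and fg: "(f, g) = B \<phi>"
      have fg': "f = (\<lambda>u\<in>verts H. fst (prod_decode (\<phi> u)))" "g = (\<lambda>u\<in>verts H. snd (prod_decode (\<phi> u)))"
        using fg by (auto simp: B_def)
      have "f u \<in> verts G \<and> g u \<in> verts G'" if "u \<in> verts H" for u
      proof -
        have "\<phi> u \<in> prod_encode ` (verts G \<times> verts G')"
          using \<phi> that by (auto simp: hypergraph_homs_def hypergraph_product_def)
        then show ?thesis using that by (auto simp: fg')
      qed
      moreover have "f ` e \<in> edges G \<and> g ` e \<in> edges G'" if e: "e \<in> edges H" for e
      proof -
        have "f ` e = (fst \<circ> prod_decode) ` (\<phi> ` e)" "g ` e = (snd \<circ> prod_decode) ` (\<phi> ` e)"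
          using sub(1)[OF e] by (auto simp: fg' image_image subset_iff intro!: image_cong)
        moreover have "\<phi> ` e \<in> edges (hypergraph_product r G G')"
          using \<phi> e by (auto simp: hypergraph_homs_def)
        ultimately show ?thesis by (simp add: hypergraph_product_def)
      qed
      ultimately show "f \<in> hypergraph_homs H G \<and> g \<in> hypergraph_homs H G'"
        by (auto simp: hypergraph_homs_def fg')
    qed
  qed
  then show ?thesis by (metis bij_betw_same_card card_cartesian_product)
qed

lemma hom_density_product:
  assumes "uniform_hypergraph r H" "uniform_hypergraph r G"
  shows "hom_density H (hypergraph_product r G G') = hom_density H G * hom_density H G'"
proof -
  have "card (verts (hypergraph_product r G G')) = card (verts G) * card (verts G')"
    by (simp add: hypergraph_product_def card_image inj_prod_encode card_cartesian_product)
  then show ?thesis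
    by (simp add: hom_density_def card_hypergraph_homs_product[OF assms] power_mult_distrib)
qed

section \<open>Densities of complete hypergraphs\<close>

lemma uniform_complete_hypergraph: "uniform_hypergraph r (complete_hypergraph r n)"
  by (simp add: uniform_hypergraph_def complete_hypergraph_def)

text \<open>Every injective map into a complete hypergraph is a homomorphism, and the falling
  factorial counting these maps is at least the power on the left. Truncated subtraction keeps the
  bound valid for small \<open>n\<close>.\<close>

lemma hom_density_complete_ge:
  assumes H: "uniform_hypergraph r H"
  shows "(real (n - card (verts H)) / real n) ^ card (verts H) \<le> hom_density H (complete_hypergraph r n)"
proof -
  let ?v = "card (verts H)"
  have fin: "finite (verts H)" using H by (simp add: uniform_hypergraph_def)
  have "(n - ?v) ^ ?v = (\<Prod>i\<in>{0..<?v}. n - ?v)" by simp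
  also have "\<dots> \<le> (\<Prod>i\<in>{0..<?v}. n - i)" by (rule prod_mono) auto
  also have "\<dots> = card {f \<in> verts H \<rightarrow>\<^sub>E {..<n}. inj_on f (verts H)}"
    using card_inj_on_subset_funcset[OF fin, of "{..<n}" "verts H"] by simp
  also have "\<dots> \<le> card (hypergraph_homs H (complete_hypergraph r n))"
  proof (rule card_mono)
    show "finite (hypergraph_homs H (complete_hypergraph r n))"
      using fin by (intro finite_hypergraph_homs) (simp_all add: complete_hypergraph_def)
    show "{f \<in> verts H \<rightarrow>\<^sub>E {..<n}. inj_on f (verts H)} \<subseteq> hypergraph_homs H (complete_hypergraph r n)"
    proof clarify
      fix f assume f: "f \<in> verts H \<rightarrow>\<^sub>E {..<n}" "inj_on f (verts H)"
      have "f ` e \<subseteq> {..<n} \<and> card (f ` e) = r" if "e \<in> edges H" for e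
      proof -
        have "e \<subseteq> verts H" "card e = r" using that H by (auto simp: uniform_hypergraph_def)
        then show ?thesis using f inj_on_subset[OF f(2)] by (auto simp: card_image)
      qed
      then show "f \<in> hypergraph_homs H (complete_hypergraph r n)"
        using f by (simp add: hypergraph_homs_def complete_hypergraph_def)
    qed
  qed
  finally have "real ((n - ?v) ^ ?v) \<le> real (card (hypergraph_homs H (complete_hypergraph r n)))"
    by (rule of_nat_mono)
  then show ?thesis
    by (simp add: hom_density_def complete_hypergraph_def power_divide divide_right_mono)
qed

lemma hom_density_complete_tendsto_1:
  assumes H: "uniform_hypergraph r H"
  shows "(\<lambda>n. hom_density H (complete_hypergraph r n)) \<longlonglongrightarrow> 1"
proof (rule tendsto_sandwich)
  let ?v = "card (verts H)"
  have "(\<lambda>n. real (n - ?v) / real n) \<longlonglongrightarrow> 1" by real_asymp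
  from tendsto_power[OF this, of ?v]
  show "(\<lambda>n. (real (n - ?v) / real n) ^ ?v) \<longlonglongrightarrow> 1" by simp
  show "\<forall>\<^sub>F n in sequentially. hom_density H (complete_hypergraph r n) \<le> 1"
    using H by (intro always_eventually allI hom_density_le_1)
      (auto simp: uniform_hypergraph_def complete_hypergraph_def)
qed (use hom_density_complete_ge[OF H] in \<open>auto intro: always_eventually\<close>)

section \<open>The profile as a monoid\<close>

lemma density_vector_in_profile:
  "uniform_hypergraph r G \<Longrightarrow> verts G \<noteq> {} \<Longrightarrow> (\<chi> i. hom_density (C i) G) \<in> hypergraph_profile r C"
  for G :: "nat hypergraph"
  unfolding hypergraph_profile_def by (rule subsetD[OF closure_subset]) blast

text \<open>Transfers closed conditions from density vectors to their limits.\<close>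

lemma hypergraph_profile_minimal:
  assumes "closed S"
    and "\<And>G :: nat hypergraph. uniform_hypergraph r G \<Longrightarrow> verts G \<noteq> {} \<Longrightarrow> (\<chi> i. hom_density (C i) G) \<in> S"
  shows "hypergraph_profile r C \<subseteq> S"
  unfolding hypergraph_profile_def by (rule closure_minimal) (use assms in auto)

lemma hypergraph_profile_le_1:
  assumes "\<And>i. uniform_hypergraph r (C i)" and "x \<in> hypergraph_profile r C"
  shows "x $ i \<le> 1"
proof -
  have "hypergraph_profile r C \<subseteq> {x. x $ i \<le> 1}"
    by (rule hypergraph_profile_minimal)
      (use assms(1) in \<open>auto simp: closed_halfspace_component_le_cart uniform_hypergraph_def intro!: hom_density_le_1\<close>)
  then show ?thesis using assms(2) by blast
qed

lemma hypergraph_profile_edgeless: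
  fixes C :: "'n::finite \<Rightarrow> 'v hypergraph"
  assumes "finite (verts (C i))" "edges (C i) = {}" and "x \<in> hypergraph_profile r C"
  shows "x $ i = 1"
proof -
  have "closed {x :: real ^ 'n. x $ i = 1}"
    by (intro closed_Collect_eq continuous_intros)
  then have "hypergraph_profile r C \<subseteq> {x. x $ i = 1}"
    by (rule hypergraph_profile_minimal)
      (use assms in \<open>auto simp: uniform_hypergraph_def intro!: hom_density_edgeless\<close>)
  then show ?thesis using assms(3) by blast
qed

text \<open>Density vectors are closed under multiplication by the product construction; continuity
  of multiplication carries this to the closure.\<close>

lemma hypergraph_profile_mult:
  assumes C: "\<And>i. uniform_hypergraph r (C i)"
    and x: "x \<in> hypergraph_profile r C" and y: "y \<in> hypergraph_profile r C"
  shows "x * y \<in> hypergraph_profile r C"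
proof -
  let ?D = "{(\<chi> i. hom_density (C i) G) | G :: nat hypergraph. uniform_hypergraph r G \<and> verts G \<noteq> {}}"
  obtain X Y where X: "\<And>n. X n \<in> ?D" "X \<longlonglongrightarrow> x" and Y: "\<And>n. Y n \<in> ?D" "Y \<longlonglongrightarrow> y"
    using x y unfolding hypergraph_profile_def closure_sequential by blast
  have "u * v \<in> ?D" if u: "u \<in> ?D" and v: "v \<in> ?D" for u v
  proof -
    obtain G G' :: "nat hypergraph" where G: "uniform_hypergraph r G" "verts G \<noteq> {}" "u = (\<chi> i. hom_density (C i) G)"
      and G': "uniform_hypergraph r G'" "verts G' \<noteq> {}" "v = (\<chi> i. hom_density (C i) G')"
      using u v by blast
    have "u * v = (\<chi> i. hom_density (C i) (hypergraph_product r G G'))"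
      using G G' by (simp add: vec_eq_iff hom_density_product[OF C])
    moreover have "verts (hypergraph_product r G G') \<noteq> {}"
      using G G' by (simp add: hypergraph_product_def)
    ultimately show ?thesis
      using uniform_hypergraph_product[OF G(1) G'(1)] by blast
  qed
  then have "X n * Y n \<in> ?D" for n using X(1) Y(1) .
  moreover have "(\<lambda>n. X n * Y n) \<longlonglongrightarrow> x * y"
    by (rule vec_tendstoI) (auto intro!: tendsto_mult tendsto_vec_nth X(2) Y(2))
  ultimately show ?thesis
    unfolding hypergraph_profile_def closure_sequential
    by (intro exI[of _ "\<lambda>n. X n * Y n"] conjI allI)
qed

lemma one_in_hypergraph_profile:
  assumes C: "\<And>i. uniform_hypergraph r (C i)"
  shows "1 \<in> hypergraph_profile r C"
proof (rule closed_sequentially)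
  show "closed (hypergraph_profile r C)" by (simp add: hypergraph_profile_def)
  \<comment> \<open>The shift to \<open>Suc n\<close> keeps the vertex set nonempty.\<close>
  show "(\<chi> i. hom_density (C i) (complete_hypergraph r (Suc n))) \<in> hypergraph_profile r C" for n
    by (intro density_vector_in_profile uniform_complete_hypergraph) (simp add: complete_hypergraph_def lessThan_empty_iff)
  show "(\<lambda>n. \<chi> i. hom_density (C i) (complete_hypergraph r (Suc n))) \<longlonglongrightarrow> 1"
  proof (rule vec_tendstoI)
    fix i
    show "(\<lambda>n. (\<chi> i. hom_density (C i) (complete_hypergraph r (Suc n))) $ i) \<longlonglongrightarrow> 1 $ i"
      using LIMSEQ_Suc[OF hom_density_complete_tendsto_1[OF C[of i]]] by simp
  qed
qed

section \<open>Small positive points of the profile\<close>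

lemma power_in_hypergraph_profile:
  assumes C: "\<And>i. uniform_hypergraph r (C i)" and x: "x \<in> hypergraph_profile r C"
  shows "x ^ m \<in> hypergraph_profile r C"
  by (induction m) (auto intro: one_in_hypergraph_profile hypergraph_profile_mult C x)

lemma vec_power_component: "(x ^ m) $ i = (x $ i) ^ m" for x :: "real ^ 'n::finite"
  by (induction m) auto

text \<open>The given point \<open>p\<close> may have zero coordinates and hence no logarithm.
  Powers of a positive density vector remain positive and tend to the 0-1 vector \<open>z\<close>
  marking the edgeless \<open>C i\<close>; this \<open>z\<close> is no longer than \<open>p\<close>,
  so high powers enter the ball.\<close>

lemma positive_point_in_ball:
  fixes C :: "'n::finite \<Rightarrow> 'v hypergraph"
  assumes r: "2 \<le> r" and C: "\<And>i. uniform_hypergraph r (C i)"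
    and p: "p \<in> hypergraph_profile r C" "norm p < \<epsilon>"
  shows "\<exists>q \<in> hypergraph_profile r C. q \<in> pos_orthant \<and> norm q < \<epsilon>"
proof -
  have "\<forall>\<^sub>F n in sequentially. \<forall>i. 0 < hom_density (C i) (complete_hypergraph r n)"
    by (rule eventually_all_finite) (rule order_tendstoD[OF hom_density_complete_tendsto_1[OF C]], simp)
  then have "\<forall>\<^sub>F n in sequentially. n > 0 \<and> (\<forall>i. 0 < hom_density (C i) (complete_hypergraph r n))"
    using eventually_gt_at_top[of 0] by eventually_elim simp
  then obtain n where n: "n > 0" "\<And>i. 0 < hom_density (C i) (complete_hypergraph r n)"
    by (auto simp: eventually_sequentially)
  define x where "x = (\<chi> i. hom_density (C i) (complete_hypergraph r n))"
  define z :: "real ^ 'n" where "z = (\<chi> i. if edges (C i) = {} then 1 else 0)"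
  have ne: "verts (complete_hypergraph r n) \<noteq> {}" using n(1) by (auto simp: complete_hypergraph_def)
  have x: "x \<in> hypergraph_profile r C"
    unfolding x_def by (intro density_vector_in_profile uniform_complete_hypergraph ne)
  have fin: "finite (verts (C i))" for i using C[of i] by (simp add: uniform_hypergraph_def)
  \<comment> \<open>Where \<open>z\<close> has a \<open>1\<close>, the hypergraph \<open>C i\<close>
    is edgeless and \<open>p\<close> has a \<open>1\<close> as well.\<close>
  have "norm z \<le> norm p"
    by (rule norm_le_componentwise_cart)
      (use hypergraph_profile_edgeless[OF fin _ p(1)] in \<open>auto simp: z_def\<close>)
  then have "norm z < \<epsilon>" using p(2) by simp
  moreover have "(\<lambda>m. x ^ m) \<longlonglongrightarrow> z"
  proof (rule vec_tendstoI)
    fix i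
    show "(\<lambda>m. (x ^ m) $ i) \<longlonglongrightarrow> z $ i"
    proof (cases "edges (C i) = {}")
      case True
      then show ?thesis
        using hypergraph_profile_edgeless[OF fin True x] by (simp add: vec_power_component z_def)
    next
      case False
      have "x $ i < 1"
        using hom_density_less_1[OF C False uniform_complete_hypergraph ne r] by (simp add: x_def)
      moreover have "0 < x $ i" using n(2) by (simp add: x_def)
      ultimately show ?thesis using False by (simp add: vec_power_component z_def LIMSEQ_realpow_zero)
    qed
  qed
  ultimately have "\<forall>\<^sub>F m in sequentially. norm (x ^ m) < \<epsilon>"
    by (intro order_tendstoD(2)[OF tendsto_norm])
  then obtain m where "norm (x ^ m) < \<epsilon>" by (auto simp: eventually_sequentially)
  moreover have "x ^ m \<in> pos_orthant"
    using n(2) by (simp add: pos_orthant_def vec_power_component x_def)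
  ultimately show ?thesis using power_in_hypergraph_profile[where C = C, OF C x] by blast
qed

text \<open>Nothing with an edge maps to an edgeless target, so one isolated vertex realises the
  zero vector.\<close>

lemma zero_in_hypergraph_profile:
  assumes "\<And>i. edges (C i) \<noteq> {}"
  shows "0 \<in> hypergraph_profile r C"
proof -
  let ?G = "Hypergraph {0} {} :: nat hypergraph"
  have "hypergraph_homs (C i) ?G = {}" for i
    using assms[of i] by (auto simp: hypergraph_homs_def)
  then have "(\<chi> i. hom_density (C i) ?G) = 0" by (simp add: vec_eq_iff hom_density_def)
  then show ?thesis
    using density_vector_in_profile[of r ?G C] by (simp add: uniform_hypergraph_def)
qed

text \<open>An edgeless \<open>C i\<close> fixes its coordinate at \<open>1\<close>, so balls of
  radius at most \<open>1\<close> then miss the profile. Hence nonemptiness is asserted when every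
  \<open>C i\<close> has an edge, and the equivalence whenever the ball meets the profile.\<close>

theorem theorem3p2:
  fixes r :: nat and C :: "'n::finite \<Rightarrow> 'v hypergraph"
  assumes "2 \<le> r"
    and "\<And>i. uniform_hypergraph r (C i)"
  shows "trop (hypergraph_profile r C) = closure (convex_cone hull (log_set (hypergraph_profile r C)))
    \<and> closure (convex_cone hull (log_set (hypergraph_profile r C)))
        = closure (convex hull (log_set (hypergraph_profile r C)))
    \<and> closure (convex hull (log_set (hypergraph_profile r C))) \<subseteq> {y. \<forall>i. y $ i \<le> 0}
    \<and> (\<forall>\<epsilon>>0.
         ((\<forall>i. edges (C i) \<noteq> {}) \<longrightarrow> hypergraph_profile r C \<inter> ball 0 \<epsilon> \<noteq> {}) \<and>
         (hypergraph_profile r C \<inter> ball 0 \<epsilon> \<noteq> {} \<longrightarrow>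
           (\<forall>a b :: real ^ 'n.
              (\<forall>y \<in> trop (hypergraph_profile r C). a \<bullet> y \<ge> b \<bullet> y) \<longleftrightarrow>
              (\<forall>y \<in> log_set (hypergraph_profile r C \<inter> ball 0 \<epsilon>). a \<bullet> y \<ge> b \<bullet> y))))"
proof -
  let ?P = "hypergraph_profile r C"
  note mult = hypergraph_profile_mult[where C = C, OF assms(2)]
  note one = one_in_hypergraph_profile[where C = C, OF assms(2)]
  note le1 = hypergraph_profile_le_1[where C = C, OF assms(2)]
  have trop: "trop ?P = closure (convex_cone hull (log_set ?P))"
    by (rule trop_eq_closure_convex_cone_hull[OF one mult])
  have hull: "convex_cone hull (log_set ?P) = convex hull (log_set ?P)"
    by (rule convex_cone_hull_eq_convex_hull[OF zero_in_log_set[OF one] log_set_add[OF mult]])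
  have local: "(\<forall>y \<in> trop ?P. a \<bullet> y \<ge> b \<bullet> y) \<longleftrightarrow> (\<forall>y \<in> log_set (?P \<inter> ball 0 \<epsilon>). a \<bullet> y \<ge> b \<bullet> y)"
    if ne: "?P \<inter> ball 0 \<epsilon> \<noteq> {}" for \<epsilon> and a b :: "real ^ 'n"
  proof
    have "log_set (?P \<inter> ball 0 \<epsilon>) \<subseteq> log_set ?P" by (auto simp: log_set_def)
    also have "\<dots> \<subseteq> trop ?P"
      unfolding trop using hull_subset closure_subset by (rule order_trans)
    finally show "\<forall>y \<in> log_set (?P \<inter> ball 0 \<epsilon>). a \<bullet> y \<ge> b \<bullet> y" if "\<forall>y \<in> trop ?P. a \<bullet> y \<ge> b \<bullet> y"
      using that by blast
  next
    assume ineq: "\<forall>y \<in> log_set (?P \<inter> ball 0 \<epsilon>). a \<bullet> y \<ge> b \<bullet> y"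
    obtain p where "p \<in> ?P" "norm p < \<epsilon>" using ne by auto
    then obtain q where q: "q \<in> ?P" "q \<in> pos_orthant" "norm q < \<epsilon>"
      using positive_point_in_ball[where C = C, OF assms] by blast
    have "0 \<le> (a - b) \<bullet> y" if "y \<in> log_set ?P" for y
      by (rule linear_inequality_on_log_set_if_near_zero[OF mult le1 q _ that])
        (use ineq in \<open>auto simp: inner_diff_left\<close>)
    then have "log_set ?P \<subseteq> {y. (a - b) \<bullet> y \<ge> 0}" by blast
    \<comment> \<open>The half-space is a closed convex cone, so the inequality passes from
      \<open>log_set ?P\<close> to all of \<open>trop ?P\<close>.\<close>
    then have "closure (convex_cone hull (log_set ?P)) \<subseteq> {y. (a - b) \<bullet> y \<ge> 0}"
      by (intro closure_minimal hull_minimal convex_cone_halfspace_ge closed_halfspace_ge)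
    then show "\<forall>y \<in> trop ?P. a \<bullet> y \<ge> b \<bullet> y"
      unfolding trop by (auto simp: inner_diff_left)
  qed
  have "?P \<inter> ball 0 \<epsilon> \<noteq> {}" if "\<epsilon> > 0" "\<forall>i. edges (C i) \<noteq> {}" for \<epsilon>
    using zero_in_hypergraph_profile[of C r] that by auto
  then show ?thesis
    using trop hull local closure_convex_hull_log_set_nonpos[OF le1] by auto
qed

end
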